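(* Let $a,b$ be coprime positive integers and fix $k$ with $0\le k\le b-1$. A chip configuration $D\ge 0$ is $k$-skeletal if and only if $\mathrm{lpath}(D)$ is a $k$-skeletal labeled path.
   Context: Write $[b]=\{1,\dots,b\}$. A chip configuration is $D:[b]\to\mathbb{Z}$; $D\ge0$ means all values nonnegative. For $S\subseteq[b]$ with $|S|=s$, the cluster-fire move $\phi_S$ subtracts $1+\lfloor (b-s)a/b\rfloor$ from $D(i)$ for $i\in S$ and adds $\lfloor sa/b\rfloor$ to $D(j)$ for $j\in[b]\setminus S$; $\beta_S=\phi_S^{-1}$. For $D\ge0$, $\phi_S$ (resp. $\beta_S$) is legal if $\phi_S(D)\ge 0$ (resp. $\beta_S(D)\ge0$). A $k$-firing move is $\phi_S$ with $0<|S|\le k+1$; $D\ge0$ is $k$-stable if no $k$-firing move is legal on $D$; $D$ is $k$-skeletal if it is $k$-stable and for every nonempty $T$ with $\beta_T$ legal on $D$, $\beta_T(D)$ is not $k$-stable. Labeled path of $D\ge0$: vertex $i$ is poorer than $j$ if $D(i)<D(j)$, or $D(i)=D(j)$ and $i<j$. Let $w_1,\dots,w_b$ be the vertices from poorest to richest and $x_t=D(w_t)$. $\mathrm{lpath}(D)$ is the lattice path starting at $(0,0)$ which has, for each $t$, a north step from $(x_t,t-1)$ to $(x_t,t)$ labeled $w_t$, consecutive north steps being joined by east steps, and which ends with east steps from $(x_b,b)$ to $(a,b)$ if $x_b\le a$ (if $x_b>a$ it ends at $(x_b,b)$). Paths: the level of a lattice point $(x,y)$ is $ay-bx$. For a lattice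 path $Q$ from $(0,0)$ to $(a,b)$ with unit north and east steps and a lattice point $v$ on $Q$, the cyclic shift $Q_v$ is the path from the origin whose steps are those of $Q$ from $v$ to $(a,b)$ followed by those from $(0,0)$ to $v$ (labels move with their north steps). $Q$ is $k$-skeletal if (R1) the last $k+1$ north steps of $Q$ start at points of level $\ge 0$, and (R2) for every lattice point $v$ on $Q$ of level $>0$, (R1) fails for $Q_v$. A labeled path is $k$-skeletal if its underlying unlabeled path is; a path not ending at $(a,b)$ is not $k$-skeletal for any $k$. *)

theory Defs
  imports Complex_Main
begin

text \<open>A chip configuration on \<open>[b] = {1..b}\<close> is a function \<open>D :: nat \<Rightarrow> int\<close> of which only the values
  on \<open>{1..b}\<close> matter.\<close>

definition nonneg_config :: "nat \<Rightarrow> (nat \<Rightarrow> int) \<Rightarrow> bool" where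
  "nonneg_config b D \<longleftrightarrow> (\<forall>i\<in>{1..b}. D i \<ge> 0)"

text \<open>\<open>div\<close> on \<open>int\<close> is division rounded down, i.e. \<open>x div y\<close> is the floor of \<open>x / y\<close>.\<close>

definition cluster_fire :: "nat \<Rightarrow> nat \<Rightarrow> nat set \<Rightarrow> (nat \<Rightarrow> int) \<Rightarrow> nat \<Rightarrow> int" where
  "cluster_fire a b S D = (\<lambda>i.
     if i \<in> S then D i - (1 + (int b - int (card S)) * int a div int b)
     else if i \<in> {1..b} then D i + int (card S) * int a div int b
     else D i)"

definition cluster_backfire :: "nat \<Rightarrow> nat \<Rightarrow> nat set \<Rightarrow> (nat \<Rightarrow> int) \<Rightarrow> nat \<Rightarrow> int" where
  "cluster_backfire a b S D = (\<lambda>i.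
     if i \<in> S then D i + (1 + (int b - int (card S)) * int a div int b)
     else if i \<in> {1..b} then D i - int (card S) * int a div int b
     else D i)"

lemma cluster_backfire_inverse:
  "cluster_backfire a b S (cluster_fire a b S D) = D"
  "cluster_fire a b S (cluster_backfire a b S D) = D"
  by (auto simp: cluster_fire_def cluster_backfire_def fun_eq_iff)

definition legal_fire :: "nat \<Rightarrow> nat \<Rightarrow> nat set \<Rightarrow> (nat \<Rightarrow> int) \<Rightarrow> bool" where
  "legal_fire a b S D \<longleftrightarrow> nonneg_config b (cluster_fire a b S D)"

definition legal_backfire :: "nat \<Rightarrow> nat \<Rightarrow> nat set \<Rightarrow> (nat \<Rightarrow> int) \<Rightarrow> bool" where
  "legal_backfire a b S D \<longleftrightarrow> nonneg_config b (cluster_backfire a b S D)"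

definition k_stable :: "nat \<Rightarrow> nat \<Rightarrow> nat \<Rightarrow> (nat \<Rightarrow> int) \<Rightarrow> bool" where
  "k_stable a b k D \<longleftrightarrow> nonneg_config b D \<and>
     (\<forall>S. S \<subseteq> {1..b} \<and> 0 < card S \<and> card S \<le> k + 1 \<longrightarrow> \<not> legal_fire a b S D)"

definition k_skeletal :: "nat \<Rightarrow> nat \<Rightarrow> nat \<Rightarrow> (nat \<Rightarrow> int) \<Rightarrow> bool" where
  "k_skeletal a b k D \<longleftrightarrow> k_stable a b k D \<and>
     (\<forall>T. T \<subseteq> {1..b} \<and> T \<noteq> {} \<and> legal_backfire a b T D \<longrightarrow>
          \<not> k_stable a b k (cluster_backfire a b T D))"

text \<open>Lattice paths start at the origin and are given by their list of unit steps. North steps carry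
  a label; \<open>unit step list\<close> is the type of unlabeled paths.\<close>

datatype 'l step = is_North: North 'l | is_East: East

definition underlying :: "'l step list \<Rightarrow> unit step list" where
  "underlying Q = map (map_step (\<lambda>_. ())) Q"

definition endpoint :: "'l step list \<Rightarrow> nat \<times> nat" where
  "endpoint Q = (length (filter is_East Q), length (filter is_North Q))"

text \<open>The lattice points on \<open>Q\<close> are \<open>path_vertex Q n\<close> for \<open>n \<le> length Q\<close>, each occurring for exactly
  one such \<open>n\<close>; accordingly the cyclic shift at a lattice point of \<open>Q\<close> is indexed by \<open>n\<close>.\<close>

definition path_vertex :: "'l step list \<Rightarrow> nat \<Rightarrow> nat \<times> nat" where
  "path_vertex Q n = endpoint (take n Q)"

definition cyclic_shift :: "nat \<Rightarrow> 'l step list \<Rightarrow> 'l step list" where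
  "cyclic_shift n Q = drop n Q @ take n Q"

definition level :: "nat \<Rightarrow> nat \<Rightarrow> nat \<times> nat \<Rightarrow> int" where
  "level a b p = int a * int (snd p) - int b * int (fst p)"

text \<open>The starting points of the north steps of \<open>Q\<close>, in the order in which \<open>Q\<close> traverses them.\<close>

definition north_starts :: "'l step list \<Rightarrow> (nat \<times> nat) list" where
  "north_starts Q = map (path_vertex Q) (filter (\<lambda>i. is_North (Q ! i)) [0..<length Q])"

definition last_norths_nonneg :: "nat \<Rightarrow> nat \<Rightarrow> nat \<Rightarrow> 'l step list \<Rightarrow> bool" where
  "last_norths_nonneg a b k Q \<longleftrightarrow>
     (\<forall>p \<in> set (take (k + 1) (rev (north_starts Q))). level a b p \<ge> 0)"

definition k_skeletal_path :: "nat \<Rightarrow> nat \<Rightarrow> nat \<Rightarrow> unit step list \<Rightarrow> bool" where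
  "k_skeletal_path a b k Q \<longleftrightarrow> endpoint Q = (a, b) \<and>
     last_norths_nonneg a b k Q \<and>
     (\<forall>n \<le> length Q. level a b (path_vertex Q n) > 0 \<longrightarrow>
        \<not> last_norths_nonneg a b k (cyclic_shift n Q))"

definition k_skeletal_labeled_path :: "nat \<Rightarrow> nat \<Rightarrow> nat \<Rightarrow> nat step list \<Rightarrow> bool" where
  "k_skeletal_labeled_path a b k Q \<longleftrightarrow> k_skeletal_path a b k (underlying Q)"

definition poorer :: "(nat \<Rightarrow> int) \<Rightarrow> nat \<Rightarrow> nat \<Rightarrow> bool" where
  "poorer D i j \<longleftrightarrow> D i < D j \<or> (D i = D j \<and> i < j)"

text \<open>\<open>sort_key\<close> is stable, so vertices of equal wealth stay in increasing order.\<close>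

definition vertex_order :: "nat \<Rightarrow> (nat \<Rightarrow> int) \<Rightarrow> nat list" where
  "vertex_order b D = sort_key D [1..<Suc b]"

lemma set_vertex_order: "set (vertex_order b D) = {1..b}"
  by (auto simp: vertex_order_def)

lemma sorted_wrt_insort_key_poorer:
  assumes "sorted_wrt (poorer D) xs" and "\<forall>y\<in>set xs. x < y"
  shows "sorted_wrt (poorer D) (insort_key D x xs)"
  using assms by (induction xs) (auto simp: set_insort_key poorer_def)

lemma sorted_wrt_vertex_order: "sorted_wrt (poorer D) (vertex_order b D)"
proof -
  have "sorted_wrt (poorer D) (sort_key D xs)" if "sorted_wrt (<) xs" for xs
    using that
  proof (induction xs)
    case (Cons x xs)
    then show ?case
      using sorted_wrt_insort_key_poorer[of D "sort_key D xs" x] by (simp add: sort_key_def)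
        (metis set_sort sort_key_def)
  qed simp
  then show ?thesis by (simp add: vertex_order_def del: upt_Suc)
qed

text \<open>The steps of the path from x-coordinate \<open>x\<close> on, the vertices still to be visited being \<open>ws\<close>.
  Since \<open>nat z = 0\<close> for \<open>z < 0\<close>, no east steps are appended once the x-coordinate exceeds \<open>a\<close>.\<close>

fun lpath_from :: "nat \<Rightarrow> (nat \<Rightarrow> int) \<Rightarrow> int \<Rightarrow> nat list \<Rightarrow> nat step list" where
  "lpath_from a D x [] = replicate (nat (int a - x)) East"
| "lpath_from a D x (w # ws) = replicate (nat (D w - x)) East @ North w # lpath_from a D (D w) ws"

definition lpath :: "nat \<Rightarrow> nat \<Rightarrow> (nat \<Rightarrow> int) \<Rightarrow> nat step list" where
  "lpath a b D = lpath_from a D 0 (vertex_order b D)"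

end

theory Submission
  imports Defs "HOL-Library.Multiset"
begin

text \<open>A configuration is recorded by its sorted list of wealths, and stability bounds the
  \<open>k + 1\<close> largest entries exactly as (R1) does. If the result of a legal backfiring move \<open>\<beta>\<^sub>T\<close> is
  stable, then \<open>T\<close> consists of the \<open>t\<close> poorest vertices, and the path of the result is the cyclic
  shift at the last point of positive level in row \<open>t\<close>. Conversely, a violation of (R2) at a point
  of level more than \<open>b\<close> passes on to the first later point of smaller level, which lies at most
  \<open>b\<close> lower; by descent there is a violation at a level in \<open>{1..b}\<close>, that is, at the last point of
  positive level in its row.\<close>

section \<open>Levels along a path\<close>

definition north_levels :: "nat \<Rightarrow> nat \<Rightarrow> 'l step list \<Rightarrow> int list" where
  "north_levels a b Q = map (level a b) (north_starts Q)"

definition final_level :: "nat \<Rightarrow> nat \<Rightarrow> 'l step list \<Rightarrow> int" where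
  "final_level a b Q = level a b (endpoint Q)"

lemma final_level_simps [simp]:
  "final_level a b [] = 0"
  "final_level a b (P @ R) = final_level a b P + final_level a b R"
  "final_level a b (North l # R) = int a + final_level a b R"
  "final_level a b (East # R) = final_level a b R - int b"
  "final_level a b (replicate n East) = - (int b * int n)"
  by (auto simp: final_level_def level_def endpoint_def algebra_simps)

lemma north_starts_snoc:
  "north_starts (P @ [s]) = north_starts P @ (if is_North s then [endpoint P] else [])"
proof -
  have "filter (\<lambda>i. is_North ((P @ [s]) ! i)) [0..<length P]
      = filter (\<lambda>i. is_North (P ! i)) [0..<length P]"
    by (rule filter_cong) (auto simp: nth_append)
  then show ?thesis
    by (auto simp: north_starts_def path_vertex_def)
qed

lemma north_levels_Nil [simp]: "north_levels a b [] = []"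
  by (simp add: north_levels_def north_starts_def)

lemma north_levels_snoc:
  "north_levels a b (P @ [s])
     = north_levels a b P @ (if is_North s then [final_level a b P] else [])"
  by (simp add: north_levels_def north_starts_snoc final_level_def)

text \<open>The level is additive in the steps, so the starting points in \<open>R\<close> are
  offset by the level at which \<open>R\<close> begins. This reduces cyclic shifts to arithmetic on
  lists of levels.\<close>

lemma north_levels_append:
  "north_levels a b (P @ R) = north_levels a b P @ map (\<lambda>l. final_level a b P + l) (north_levels a b R)"
proof (induction R rule: rev_induct)
  case (snoc s R)
  then show ?case
    using north_levels_snoc[of a b "P @ R" s] by (simp add: north_levels_snoc)
qed simp

lemma north_levels_single [simp]:
  "north_levels a b [North l] = [0]" "north_levels a b [East] = []"
  using north_levels_snoc[of a b "[]" "North l"] north_levels_snoc[of a b "[]" East] by simp_all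

lemma north_levels_replicate_East [simp]:
  "north_levels a b (replicate n (East :: 'l step)) = []"
proof (induction n)
  case (Suc n)
  then show ?case
    using north_levels_append[of a b "[East :: 'l step]" "replicate n East"] by simp
qed simp

section \<open>Cyclic shifts, (R1), and descent to a low level\<close>

lemma last_norths_nonneg_iff:
  "last_norths_nonneg a b k Q \<longleftrightarrow> (\<forall>l\<in>set (take (k + 1) (rev (north_levels a b Q))). l \<ge> 0)"
  by (simp add: last_norths_nonneg_def north_levels_def rev_map take_map)

text \<open>In the second case \<open>M\<close> ends at the first point of negative level: the level
  drops only along an east step, and then by \<open>b\<close>, so it cannot jump below
  \<open>- int b\<close>.\<close>

lemma negative_prefix:
  "((\<forall>l\<in>set (north_levels a b S). l \<ge> 0) \<and> final_level a b S \<ge> 0) \<or>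
   (\<exists>M R. S = M @ R \<and> (\<forall>l\<in>set (north_levels a b M). l \<ge> 0) \<and>
      final_level a b M < 0 \<and> final_level a b M \<ge> - int b)"
proof (induction S rule: rev_induct)
  case (snoc s S)
  from snoc.IH show ?case
  proof (elim disjE exE conjE)
    assume nonneg: "\<forall>l\<in>set (north_levels a b S). l \<ge> 0" "final_level a b S \<ge> 0"
    show ?thesis
    proof (cases "final_level a b (S @ [s]) \<ge> 0")
      case True
      then show ?thesis
        using nonneg by (intro disjI1) (auto simp: north_levels_snoc)
    next
      case False
      moreover from this nonneg have "s = East"
        by (cases s) auto
      ultimately show ?thesis
        using nonneg by (intro disjI2 exI[of _ "S @ [s]"] exI[of _ "[]"])
          (simp add: north_levels_snoc)
    qed
  next
    fix M R
    assume "S = M @ R" "\<forall>l\<in>set (north_levels a b M). l \<ge> 0"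
      "final_level a b M < 0" "final_level a b M \<ge> - int b"
    then show ?thesis
      by (intro disjI2 exI[of _ M] exI[of _ "R @ [s]"]) simp
  qed
qed simp

text \<open>As the total level is 0, moving \<open>M\<close> to the end raises every level by
  \<open>- ?m\<close>, which is nonnegative. North steps of \<open>M\<close> thus stay at
  nonnegative level, and those of \<open>S\<close> among the last \<open>k + 1\<close> were already
  among the last \<open>k + 1\<close> before the move.\<close>

lemma last_norths_nonneg_rotate:
  assumes R1: "last_norths_nonneg a b k (M @ S)"
    and M: "\<forall>l\<in>set (north_levels a b M). l \<ge> 0" "final_level a b M \<le> 0"
    and total: "final_level a b (M @ S) = 0"
  shows "last_norths_nonneg a b k (S @ M)"
proof -
  let ?m = "final_level a b M"
  have S: "final_level a b S = - ?m"
    using total by simp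
  define ms ss where "ms = rev (north_levels a b M)" and "ss = rev (north_levels a b S)"
  have "rev (north_levels a b (S @ M)) = map (\<lambda>l. l - ?m) ms @ ss"
    by (simp add: north_levels_append S ms_def ss_def rev_map)
  moreover have "set (take (k + 1) (map (\<lambda>l. l - ?m) ms @ ss))
      \<subseteq> (\<lambda>l. l - ?m) ` set ms \<union> set (take (k + 1) ss)"
    using set_take_subset[of "k + 1" "map (\<lambda>l. l - ?m) ms"]
      set_take_subset_set_take[of "k + 1 - length ms" "k + 1" ss] by auto
  moreover have "\<forall>l\<in>set (take (k + 1) ss). ?m + l \<ge> 0"
    using R1 by (auto simp: last_norths_nonneg_iff north_levels_append ms_def ss_def rev_map take_map)
  moreover have "\<forall>l\<in>set ms. l \<ge> 0"
    using M by (simp add: ms_def)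
  ultimately show ?thesis
    using M(2) unfolding last_norths_nonneg_iff by fastforce
qed

lemma low_violation:
  assumes "final_level a b (P @ S) = 0" "final_level a b P > 0" "last_norths_nonneg a b k (S @ P)"
  shows "\<exists>P' S'. P' @ S' = P @ S \<and> 0 < final_level a b P' \<and> final_level a b P' \<le> int b \<and>
           last_norths_nonneg a b k (S' @ P')"
  using assms
proof (induction "nat (final_level a b P)" arbitrary: P S rule: less_induct)
  case less
  show ?case
  proof (cases "final_level a b P \<le> int b")
    case False
    have "final_level a b S < 0"
      using less.prems by simp
    then obtain M R where MR: "S = M @ R" "\<forall>l\<in>set (north_levels a b M). l \<ge> 0"
        "final_level a b M < 0" "final_level a b M \<ge> - int b"
      using negative_prefix[of a b S] by auto
    \<comment> \<open>\<open>M\<close> lowers the level by at least 1 and at most \<open>b\<close>,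
      so from above \<open>b\<close> the cut after \<open>P @ M\<close> still has positive level
      while the measure decreases.\<close>
    have "last_norths_nonneg a b k ((R @ P) @ M)"
      by (rule last_norths_nonneg_rotate) (use less.prems MR in auto)
    then show ?thesis
      using less.hyps[of "P @ M" R] less.prems MR False by auto
  qed (use less.prems in blast)
qed

section \<open>The path of a sorted list of wealths\<close>

text \<open>The final abscissa \<open>e\<close> is a parameter, so that both pieces of a path cut at
  any abscissa are again of this form.\<close>

fun upath :: "int \<Rightarrow> int \<Rightarrow> int list \<Rightarrow> unit step list" where
  "upath e x [] = replicate (nat (e - x)) East"
| "upath e x (y # ys) = replicate (nat (y - x)) East @ North () # upath e y ys"

lemma underlying_lpath_from:
  "underlying (lpath_from a D x ws) = upath (int a) x (map D ws)"
  by (induction ws arbitrary: x) (auto simp: underlying_def)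

lemma upath_translate: "upath (e + c) (x + c) (map (\<lambda>y. y + c) ys) = upath e x ys"
  by (induction ys arbitrary: x) auto

text \<open>The cut falls within a single run of east steps, possibly at one of its ends. The
  hypotheses keep both parts of that run nonnegative, so \<open>nat\<close> truncates nothing and
  the lengths add up.\<close>

lemma upath_append:
  assumes "sorted (x # ys)" "\<forall>y\<in>set (x # ys). y \<le> m" "\<forall>z\<in>set zs. m \<le> z" "m \<le> e"
  shows "upath e x (ys @ zs) = upath m x ys @ upath e m zs"
  using assms
proof (induction ys arbitrary: x)
  case Nil
  show ?case
  proof (cases zs)
    case Nil
    then show ?thesis
      using Nil.prems by (simp add: replicate_add[symmetric] nat_add_distrib[symmetric])
  next
    case (Cons z zs')
    have "nat (z - x) = nat (m - x) + nat (z - m)"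
      using Nil.prems Cons by auto
    then show ?thesis
      using Cons by (simp add: replicate_add)
  qed
qed auto

text \<open>Every cut of the step list is geometric: \<open>m\<close> is the abscissa of the cut
  point and \<open>ys\<close> holds the north steps before it. The induction strips one step at a
  time.\<close>

lemma upath_split:
  assumes "upath e x zs = P @ R" "sorted (x # zs)" "\<forall>z\<in>set (x # zs). z \<le> e"
  shows "\<exists>m ys ys'. zs = ys @ ys' \<and> x \<le> m \<and> m \<le> e \<and> (\<forall>y\<in>set ys. y \<le> m) \<and> (\<forall>y\<in>set ys'. m \<le> y) \<and>
           P = upath m x ys \<and> R = upath e m ys'"
  using assms
proof (induction P arbitrary: x zs)
  case Nil
  then show ?case
    by (intro exI[of _ x] exI[of _ "[]"] exI[of _ zs]) auto
next
  case (Cons s P)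
  show ?case
  \<comment> \<open>The path begins with a north step exactly in this case; otherwise its first step
    is east and the rest is the path from \<open>x + 1\<close>.\<close>
  proof (cases "zs \<noteq> [] \<and> hd zs = x")
    case True
    then obtain zs' where zs: "zs = x # zs'"
      by (cases zs) auto
    obtain m ys ys' where IH: "zs' = ys @ ys'" "x \<le> m" "m \<le> e" "\<forall>y\<in>set ys. y \<le> m"
        "\<forall>y\<in>set ys'. m \<le> y" "P = upath m x ys" "R = upath e m ys'"
      using Cons.IH[of x zs'] Cons.prems zs by auto
    then show ?thesis
      using Cons.prems(1) zs
      by (intro exI[of _ m] exI[of _ "x # ys"] exI[of _ ys']) auto
  next
    case False
    have less: "x < e \<and> (\<forall>z\<in>set zs. x < z)"
    proof (cases zs)
      case Nil
      then show ?thesis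
        using Cons.prems by (cases "x < e") auto
    next
      case (Cons z zs')
      then show ?thesis
        using False Cons.prems by fastforce
    qed
    then have less_x: "x + 1 \<le> e" "\<forall>z\<in>set zs. x + 1 \<le> z"
      by auto
    have "upath e x zs = East # upath e (x + 1) zs"
    proof (cases zs)
      case Nil
      have "nat (e - x) = Suc (nat (e - (x + 1)))"
        using less by linarith
      then show ?thesis
        using Nil by simp
    next
      case (Cons z zs')
      have "nat (z - x) = Suc (nat (z - (x + 1)))"
        using less Cons by auto
      then show ?thesis
        using Cons by simp
    qed
    then have s: "s = East" "upath e (x + 1) zs = P @ R"
      using Cons.prems(1) by auto
    obtain m ys ys' where IH: "zs = ys @ ys'" "x + 1 \<le> m" "m \<le> e" "\<forall>y\<in>set ys. y \<le> m"
        "\<forall>y\<in>set ys'. m \<le> y" "P = upath m (x + 1) ys" "R = upath e m ys'"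
      using Cons.IH[OF s(2)] less_x Cons.prems by auto
    have "upath m x ys = East # upath m (x + 1) ys"
    proof (cases ys)
      case Nil
      have "nat (m - x) = Suc (nat (m - (x + 1)))"
        using IH(2) by linarith
      then show ?thesis
        using Nil by simp
    next
      case (Cons y ys'')
      have "nat (y - x) = Suc (nat (y - (x + 1)))"
        using less IH Cons by auto
      then show ?thesis
        using Cons by simp
    qed
    then show ?thesis
      using IH s by (intro exI[of _ m] exI[of _ ys] exI[of _ ys']) auto
  qed
qed

lemma endpoint_upath:
  assumes "sorted (x # ys)" "\<forall>y\<in>set (x # ys). y \<le> e"
  shows "endpoint (upath e x ys) = (nat (e - x), length ys)"
  using assms by (induction ys arbitrary: x) (auto simp: endpoint_def)

lemma north_levels_upath:
  assumes "sorted (x # ys)"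
  shows "north_levels a b (upath e x ys)
           = map (\<lambda>i. int a * int i - int b * (ys ! i - x)) [0..<length ys]"
  using assms
proof (induction ys arbitrary: x)
  case (Cons y ys)
  have split: "upath e x (y # ys) = (replicate (nat (y - x)) East @ [North ()]) @ upath e y ys"
    by simp
  have "north_levels a b (upath e x (y # ys))
      = - (int b * (y - x)) # map (\<lambda>l. int a - int b * (y - x) + l) (north_levels a b (upath e y ys))"
    using Cons.prems unfolding split north_levels_append by simp
  also have "\<dots> = - (int b * (y - x)) #
      map (\<lambda>i. int a * int (Suc i) - int b * (ys ! i - x)) [0..<length ys]"
    using Cons by (auto simp: algebra_simps)
  also have "\<dots> = map (\<lambda>i. int a * int i - int b * ((y # ys) ! i - x)) [0..<length (y # ys)]"
    by (simp add: upt_conv_Cons map_Suc_upt[symmetric] del: upt_Suc)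
  finally show ?case .
qed simp

lemma set_take_rev_map_upt:
  "set (take j (rev (map f [0..<n]))) = f ` {n - j..<n}"
  by (simp add: take_rev drop_map)

lemma last_norths_nonneg_upath:
  assumes "sorted ys" "\<forall>y\<in>set ys. 0 \<le> y"
  shows "last_norths_nonneg a b k (upath e 0 ys)
    \<longleftrightarrow> (\<forall>i\<in>{length ys - (k + 1)..<length ys}. int b * ys ! i \<le> int a * int i)"
  using assms by (simp add: last_norths_nonneg_iff north_levels_upath set_take_rev_map_upt
      del: take_rev upt_Suc)

text \<open>The piece after the cut moves left by \<open>m\<close> to start at 0, the piece before
  it moves right by \<open>e - m\<close> to end at \<open>e\<close>. With \<open>e = int a\<close>
  these are the changes of wealth under backfiring.\<close>

lemma upath_rotate:
  assumes "sorted ys" "sorted zs" "\<forall>y\<in>set ys. 0 \<le> y \<and> y \<le> m" "\<forall>z\<in>set zs. m \<le> z \<and> z \<le> e"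
    "0 \<le> m" "m \<le> e"
  shows "upath e m zs @ upath m 0 ys
           = upath e 0 (map (\<lambda>z. z - m) zs @ map (\<lambda>y. y + (e - m)) ys)"
proof -
  have "upath e 0 (map (\<lambda>z. z - m) zs @ map (\<lambda>y. y + (e - m)) ys)
      = upath (e - m) 0 (map (\<lambda>z. z - m) zs) @ upath e (e - m) (map (\<lambda>y. y + (e - m)) ys)"
    using assms by (intro upath_append) (auto simp: sorted_map)
  also have "upath (e - m) 0 (map (\<lambda>z. z - m) zs) = upath e m zs"
    using upath_translate[of e "- m" m zs] by simp
  also have "upath e (e - m) (map (\<lambda>y. y + (e - m)) ys) = upath m 0 ys"
    using upath_translate[of m "e - m" 0 ys] by simp
  finally show ?thesis ..
qed

section \<open>Sorted wealths\<close>

definition wealths :: "nat \<Rightarrow> (nat \<Rightarrow> int) \<Rightarrow> int list" where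
  "wealths b D = map D (vertex_order b D)"

lemma underlying_lpath: "underlying (lpath a b D) = upath (int a) 0 (wealths b D)"
  by (simp add: lpath_def underlying_lpath_from wealths_def)

lemma mset_vertex_order: "mset (vertex_order b D) = mset [1..<Suc b]"
  by (simp add: vertex_order_def del: upt_Suc)

lemma length_vertex_order [simp]: "length (vertex_order b D) = b"
  by (simp add: vertex_order_def del: upt_Suc)

lemma distinct_vertex_order: "distinct (vertex_order b D)"
  by (simp add: vertex_order_def del: upt_Suc)

lemma wealths_facts:
  shows length_wealths [simp]: "length (wealths b D) = b"
    and sorted_wealths: "sorted (wealths b D)"
    and set_wealths: "set (wealths b D) = D ` {1..b}"
  by (simp_all add: wealths_def set_vertex_order)
    (simp add: vertex_order_def)

text \<open>A sorted list is determined by its multiset, so the wealths after a move can be found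
  without tracking the new vertex order.\<close>

lemma wealths_eqI:
  assumes "sorted ys" "mset ys = image_mset D (mset [1..<Suc b])"
  shows "ys = wealths b D"
proof -
  have "mset ys = mset (wealths b D)"
    using assms(2) by (simp only: wealths_def mset_map mset_vertex_order)
  then show ?thesis
    using assms(1) sorted_wealths by (metis properties_for_sort)
qed

section \<open>Stability as a bound on the largest wealths\<close>

lemma int_le_div_iff:
  fixes b c x :: int
  assumes "b > 0"
  shows "c \<le> x div b \<longleftrightarrow> b * c \<le> x"
proof -
  have "c \<le> x div b \<longleftrightarrow> real_of_int c \<le> of_int x / of_int b"
    by (metis floor_divide_of_int_eq le_floor_iff)
  also have "\<dots> \<longleftrightarrow> real_of_int (b * c) \<le> of_int x"
    using assms by (simp add: pos_le_divide_eq mult.commute)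
  finally show ?thesis
    by (simp only: of_int_le_iff)
qed

text \<open>The best candidate is the set of the \<open>s\<close> richest vertices, the poorest of
  which has index \<open>b - s\<close>. If that vertex fails, so do the \<open>b - s + 1\<close>
  poorest ones, leaving fewer than \<open>s\<close> vertices.\<close>

lemma rich_cluster_iff:
  assumes "0 < s" "s \<le> b"
  shows "(\<exists>S. S \<subseteq> {1..b} \<and> card S = s \<and> (\<forall>i\<in>S. c < D i)) \<longleftrightarrow> c < wealths b D ! (b - s)"
proof
  assume "\<exists>S. S \<subseteq> {1..b} \<and> card S = s \<and> (\<forall>i\<in>S. c < D i)"
  then obtain S where S: "S \<subseteq> {1..b}" "card S = s" "\<forall>i\<in>S. c < D i"
    by blast
  show "c < wealths b D ! (b - s)"
  proof (rule ccontr)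
    assume neg: "\<not> c < wealths b D ! (b - s)"
    let ?P = "set (take (b - s + 1) (vertex_order b D))"
    have "D i \<le> c" if "i \<in> ?P" for i
    proof -
      obtain j where j: "j < b - s + 1" "j < b" "i = vertex_order b D ! j"
        using \<open>i \<in> ?P\<close> by (auto simp: in_set_conv_nth)
      then have "D i = wealths b D ! j"
        by (simp add: wealths_def)
      also have "\<dots> \<le> wealths b D ! (b - s)"
        using j assms by (intro sorted_nth_mono sorted_wealths) auto
      finally show ?thesis
        using neg by simp
    qed
    then have "S \<inter> ?P = {}"
      using S(3) by force
    moreover have "?P \<subseteq> {1..b}"
      using set_take_subset set_vertex_order by metis
    ultimately have "card S + card ?P \<le> card {1..b}"
      using S(1) by (metis Un_least card_Un_disjoint card_mono finite_atLeastAtMost finite_subset)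
    moreover have "card ?P = b - s + 1"
      using assms by (simp add: distinct_card distinct_vertex_order)
    ultimately show False
      using S(2) assms by simp
  qed
next
  assume rich: "c < wealths b D ! (b - s)"
  let ?S = "set (drop (b - s) (vertex_order b D))"
  have "c < D i" if "i \<in> ?S" for i
  proof -
    obtain j where j: "j < s" "i = vertex_order b D ! (b - s + j)"
      using \<open>i \<in> ?S\<close> assms by (auto simp: in_set_conv_nth)
    then have "D i = wealths b D ! (b - s + j)"
      using assms by (simp add: wealths_def)
    moreover have "wealths b D ! (b - s) \<le> wealths b D ! (b - s + j)"
      using j assms by (intro sorted_nth_mono sorted_wealths) auto
    ultimately show ?thesis
      using rich by simp
  qed
  moreover have "?S \<subseteq> {1..b}"
    using set_drop_subset set_vertex_order by metis
  moreover have "card ?S = s"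
    using assms by (simp add: distinct_card distinct_vertex_order)
  ultimately show "\<exists>S. S \<subseteq> {1..b} \<and> card S = s \<and> (\<forall>i\<in>S. c < D i)"
    by blast
qed

text \<open>Vertices outside \<open>S\<close> only gain, and an integer wealth survives a loss of
  \<open>1 + q\<close> iff it exceeds \<open>q\<close>.\<close>

lemma legal_fire_iff:
  assumes "nonneg_config b D" "S \<subseteq> {1..b}"
  shows "legal_fire a b S D \<longleftrightarrow> (\<forall>i\<in>S. (int b - int (card S)) * int a div int b < D i)"
proof -
  have "0 \<le> int (card S) * int a div int b"
    by (simp add: div_int_pos_iff)
  then show ?thesis
    using assms unfolding legal_fire_def nonneg_config_def cluster_fire_def by fastforce
qed

text \<open>For each size \<open>s\<close> only the \<open>s\<close> richest vertices need testing.
  Clearing the floor turns the test into nonnegativity of the level at which north step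
  \<open>i = b - s\<close> (counted from 0) starts, as in (R1).\<close>

lemma k_stable_iff:
  assumes "b > 0" "k \<le> b - 1" "nonneg_config b D"
  shows "k_stable a b k D
    \<longleftrightarrow> (\<forall>i\<in>{b - (k + 1)..<b}. int b * wealths b D ! i \<le> int a * int i)"
proof -
  have "k_stable a b k D \<longleftrightarrow> (\<forall>s\<in>{1..k + 1}. \<not> (\<exists>S. S \<subseteq> {1..b} \<and> card S = s \<and>
      (\<forall>i\<in>S. (int b - int s) * int a div int b < D i)))"
    using assms(3) legal_fire_iff[OF assms(3)] unfolding k_stable_def
    by (auto simp: Suc_le_eq)
  also have "\<dots> \<longleftrightarrow> (\<forall>s\<in>{1..k + 1}. wealths b D ! (b - s) \<le> (int b - int s) * int a div int b)"
    using assms by (intro ball_cong refl, subst rich_cluster_iff) auto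
  also have "\<dots> \<longleftrightarrow> (\<forall>s\<in>{1..k + 1}. int b * wealths b D ! (b - s) \<le> int a * int (b - s))"
    using assms by (intro ball_cong refl) (auto simp: int_le_div_iff of_nat_diff mult.commute)
  also have "\<dots> \<longleftrightarrow> (\<forall>i\<in>{b - (k + 1)..<b}. int b * wealths b D ! i \<le> int a * int i)"
  proof (intro iffI ballI)
    fix i
    assume all: "\<forall>s\<in>{1..k + 1}. int b * wealths b D ! (b - s) \<le> int a * int (b - s)"
      and "i \<in> {b - (k + 1)..<b}"
    then have "b - i \<in> {1..k + 1}" "b - (b - i) = i"
      by auto
    then show "int b * wealths b D ! i \<le> int a * int i"
      using bspec[OF all, of "b - i"] by simp
  qed (use assms in auto)
  finally show ?thesis .
qed

lemma k_stable_iff_path: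
  assumes "b > 0" "k \<le> b - 1" "nonneg_config b D"
  shows "k_stable a b k D \<longleftrightarrow> last_norths_nonneg a b k (upath e 0 (wealths b D))"
  using assms by (subst last_norths_nonneg_upath)
    (auto simp: k_stable_iff sorted_wealths set_wealths nonneg_config_def)

text \<open>A single vertex is an admissible cluster for every \<open>k\<close>. The bound makes the
  path of a stable configuration end at abscissa \<open>a\<close>, and it also locates
  \<open>T\<close> when applied after backfiring.\<close>

lemma k_stable_less:
  assumes "a > 0" "b > 0" "k_stable a b k D" "i \<in> {1..b}"
  shows "D i < int a"
proof -
  have "\<not> legal_fire a b {i} D" "nonneg_config b D"
    using assms unfolding k_stable_def by auto
  then have "D i \<le> (int b - 1) * int a div int b"
    using assms(4) by (auto simp: legal_fire_iff)
  then have "int b * D i \<le> (int b - 1) * int a"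
    using assms(2) by (simp add: int_le_div_iff)
  also have "\<dots> < int b * int a"
    using assms(1) by (simp add: algebra_simps)
  finally show ?thesis
    using assms(2) by simp
qed

section \<open>Backfiring as a cyclic shift\<close>

text \<open>Wealth exactly \<open>m\<close> may occur both inside and outside \<open>T\<close>, so
  \<open>T\<close> need not be an initial segment of the vertex order; the wealths of
  \<open>T\<close> still form an initial segment of the sorted list.\<close>

lemma wealths_shift:
  fixes m :: int
  assumes T: "T \<subseteq> {1..b}"
    and D: "\<forall>i\<in>{1..b}. D i \<le> int a" "nonneg_config b D"
    and low: "\<forall>i\<in>T. D i \<le> m" and high: "\<forall>i\<in>{1..b} - T. m \<le> D i"
    and D': "\<forall>i\<in>{1..b}. D' i = (if i \<in> T then D i + (int a - m) else D i - m)"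
  shows "\<exists>ys zs. wealths b D = ys @ zs \<and> length ys = card T \<and>
    (\<forall>y\<in>set ys. 0 \<le> y \<and> y \<le> m) \<and> (\<forall>z\<in>set zs. m \<le> z \<and> z \<le> int a) \<and>
    wealths b D' = map (\<lambda>z. z - m) zs @ map (\<lambda>y. y + (int a - m)) ys"
proof -
  let ?V = "[1..<Suc b]"
  define ts us where "ts = filter (\<lambda>i. i \<in> T) ?V" and "us = filter (\<lambda>i. i \<notin> T) ?V"
  define ys zs where "ys = sort (map D ts)" and "zs = sort (map D us)"
  have ts: "set ts = T" and us: "set us = {1..b} - T"
    using T by (auto simp: ts_def us_def)
  have V: "mset ?V = mset ts + mset us"
    unfolding ts_def us_def mset_filter by (rule multiset_partition)
  have ys: "\<forall>y\<in>set ys. 0 \<le> y \<and> y \<le> m" and zs: "\<forall>z\<in>set zs. m \<le> z \<and> z \<le> int a"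
    using D low high ts us T by (auto simp: ys_def zs_def nonneg_config_def)
  have "wealths b D = ys @ zs"
  proof (rule wealths_eqI[symmetric])
    show "sorted (ys @ zs)"
      using ys zs by (force simp: sorted_append ys_def zs_def)
    show "mset (ys @ zs) = image_mset D (mset ?V)"
      unfolding V by (simp add: ys_def zs_def)
  qed
  moreover have "length ys = card T"
  proof -
    have "distinct ts"
      by (simp add: ts_def)
    then show ?thesis
      using ts distinct_card by (fastforce simp: ys_def)
  qed
  moreover have "map (\<lambda>z. z - m) zs @ map (\<lambda>y. y + (int a - m)) ys = wealths b D'"
  proof (rule wealths_eqI)
    have "sorted (map (\<lambda>z. z - m) zs)" "sorted (map (\<lambda>y. y + (int a - m)) ys)"
      by (simp_all add: sorted_map ys_def zs_def)
    \<comment> \<open>The value \<open>int a - m\<close> separates the two blocks, because all old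
      wealths lie between 0 and \<open>int a\<close>.\<close>
    moreover have "\<forall>z\<in>set zs. \<forall>y\<in>set ys. z - m \<le> y + (int a - m)"
      using ys zs by force
    ultimately show "sorted (map (\<lambda>z. z - m) zs @ map (\<lambda>y. y + (int a - m)) ys)"
      by (auto simp: sorted_append)
    have "image_mset D' (mset ts) = image_mset (\<lambda>i. D i + (int a - m)) (mset ts)"
      using D' ts T by (intro image_mset_cong) auto
    moreover have "image_mset D' (mset us) = image_mset (\<lambda>i. D i - m) (mset us)"
      using D' us by (intro image_mset_cong) auto
    ultimately show "mset (map (\<lambda>z. z - m) zs @ map (\<lambda>y. y + (int a - m)) ys)
        = image_mset D' (mset ?V)"
      unfolding V by (simp add: ys_def zs_def image_mset.compositionality comp_def)
  qed
  ultimately show ?thesis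
    using ys zs by (intro exI[of _ ys] exI[of _ zs]) simp
qed

text \<open>\<open>m\<close> is the largest abscissa at which row \<open>t\<close> has positive level. For \<open>t < b\<close> coprimality
  makes it the floor of \<open>t a / b\<close>; for \<open>t = b\<close> it is \<open>a - 1\<close>.\<close>

lemma backfire_amounts:
  fixes a b t :: nat and m :: int
  assumes "coprime a b" "0 < t" "t \<le> b"
    and m: "0 < int a * int t - int b * m" "int a * int t - int b * m \<le> int b"
  shows "1 + (int b - int t) * int a div int b = int a - m"
    and "t < b \<Longrightarrow> int t * int a div int b = m"
proof -
  \<comment> \<open>The remainder is \<open>b\<close> minus the level, which is in range since the
    level lies in \<open>{1..b}\<close>.\<close>
  have "(int b - int t) * int a div int b = int a - m - 1"
    using assms by (intro int_div_pos_eq[of _ _ _ "int b - (int a * int t - int b * m)"])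
      (auto simp: algebra_simps)
  then show "1 + (int b - int t) * int a div int b = int a - m"
    by simp
  assume "t < b"
  \<comment> \<open>Once level \<open>b\<close> is excluded, the level itself is a valid remainder
    modulo \<open>b\<close>.\<close>
  have "int a * int t - int b * m \<noteq> int b"
  proof
    assume "int a * int t - int b * m = int b"
    then have "int a * int t = int b * (m + 1)"
      by (simp add: algebra_simps)
    then have "int b dvd int a * int t"
      by simp
    then have "b dvd a * t"
      by (metis of_nat_dvd_iff of_nat_mult)
    then have "b dvd t"
      using assms(1) by (simp add: coprime_commute coprime_dvd_mult_right_iff)
    then show False
      using \<open>t < b\<close> \<open>0 < t\<close> by (simp add: nat_dvd_not_less)
  qed
  then show "int t * int a div int b = m"
    using m by (intro int_div_pos_eq[of _ _ _ "int a * int t - int b * m"]) (auto simp: algebra_simps)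
qed

text \<open>For \<open>card T = b\<close> the loss prescribed outside \<open>T\<close> would be
  \<open>a\<close> and not \<open>m = a - 1\<close>, but then no vertex lies outside
  \<open>T\<close>.\<close>

lemma cluster_backfire_eq:
  fixes m :: int
  assumes "coprime a b" "T \<subseteq> {1..b}" "T \<noteq> {}"
    "0 < int a * int (card T) - int b * m" "int a * int (card T) - int b * m \<le> int b"
    "i \<in> {1..b}"
  shows "cluster_backfire a b T D i = (if i \<in> T then D i + (int a - m) else D i - m)"
proof -
  have fin: "finite T"
    using assms(2) finite_subset by blast
  have t: "0 < card T" "card T \<le> b"
    using assms(2,3) fin card_mono[of "{1..b}" T] by (auto simp: card_gt_0_iff)
  have "card T < b" if "i \<notin> T"
  proof -
    have "T \<subset> {1..b}"
      using that assms(2,6) by blast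
    then show ?thesis
      using psubset_card_mono[of "{1..b}" T] by simp
  qed
  then show ?thesis
    using backfire_amounts[OF assms(1) t assms(4,5)] assms(6) by (auto simp: cluster_backfire_def)
qed

theorem theorem4p1:
  fixes a b k :: nat and D :: "nat \<Rightarrow> int"
  assumes "a > 0" and "b > 0" and "coprime a b" and "k \<le> b - 1"
    and "nonneg_config b D"
  shows "k_skeletal a b k D \<longleftrightarrow> k_skeletal_labeled_path a b k (lpath a b D)"
proof -
  define Q where "Q = upath (int a) 0 (wealths b D)"
  have labeled: "k_skeletal_labeled_path a b k (lpath a b D) \<longleftrightarrow> k_skeletal_path a b k Q"
    by (simp add: k_skeletal_labeled_path_def underlying_lpath Q_def)
  have stable: "k_stable a b k D \<longleftrightarrow> last_norths_nonneg a b k Q"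
    unfolding Q_def using assms by (intro k_stable_iff_path) auto
  have vertex_level: "level a b (path_vertex Q n) = final_level a b (take n Q)" for n
    by (simp add: path_vertex_def final_level_def)
  show ?thesis
  proof (cases "k_stable a b k D")
    case False
    then show ?thesis
      by (simp add: labeled stable k_skeletal_def k_skeletal_path_def)
  next
    case True
    have D_less: "\<forall>i\<in>{1..b}. D i < int a"
      using k_stable_less True assms by blast
    have ws: "sorted (wealths b D)" "\<forall>w\<in>set (wealths b D). 0 \<le> w \<and> w \<le> int a"
      using D_less assms(5) by (auto simp: sorted_wealths set_wealths nonneg_config_def)
    have endQ: "endpoint Q = (a, b)"
      using ws by (simp add: Q_def endpoint_upath)
    have final_upath: "final_level a b (upath m 0 ys) = int a * int (length ys) - int b * m"
      if "sorted ys" "\<forall>y\<in>set ys. 0 \<le> y \<and> y \<le> m" "0 \<le> m" for m ys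
      using that by (simp add: final_level_def endpoint_upath level_def)
    have "(\<exists>T. T \<subseteq> {1..b} \<and> T \<noteq> {} \<and> legal_backfire a b T D \<and>
             k_stable a b k (cluster_backfire a b T D)) \<longleftrightarrow>
          (\<exists>n\<le>length Q. level a b (path_vertex Q n) > 0 \<and>
             last_norths_nonneg a b k (cyclic_shift n Q))" (is "?L \<longleftrightarrow> ?R")
    proof
      assume ?L
      then obtain T where T: "T \<subseteq> {1..b}" "T \<noteq> {}" "legal_backfire a b T D"
          "k_stable a b k (cluster_backfire a b T D)"
        by blast
      define t where "t = card T"
      \<comment> \<open>Subtracting 1 makes \<open>m\<close> the largest integer with
        \<open>int b * m < int a * int t\<close>, with strict inequality even for
        \<open>t = b\<close>.\<close>
      define m where "m = (int a * int t - 1) div int b"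
      define D' where "D' = cluster_backfire a b T D"
      have "0 < t"
        using T finite_subset[OF T(1)] by (simp add: t_def card_gt_0_iff)
      have "t \<le> b"
        using card_mono[OF _ T(1)] by (simp add: t_def)
      have atb: "int a * int t - 1 = int b * m + (int a * int t - 1) mod int b"
        by (simp add: m_def)
      moreover have "0 \<le> (int a * int t - 1) mod int b" "(int a * int t - 1) mod int b < int b"
        using assms(2) by simp_all
      ultimately have m: "0 < int a * int t - int b * m" "int a * int t - int b * m \<le> int b"
        by linarith+
      have "int a * int t > 0"
        using \<open>0 < t\<close> assms(1) by simp
      then have "0 \<le> m"
        using assms(2) by (simp add: m_def pos_imp_zdiv_nonneg_iff)
      have "int b * m < int b * int a"
        using m(1) \<open>t \<le> b\<close> mult_left_mono[of "int t" "int b" "int a"] by (simp add: mult.commute)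
      then have "m < int a"
        by (simp add: mult_less_cancel_left)
      have D': "\<forall>i\<in>{1..b}. D' i = (if i \<in> T then D i + (int a - m) else D i - m)"
        unfolding D'_def using m T assms(3) by (intro ballI cluster_backfire_eq) (auto simp: t_def)
      \<comment> \<open>Stability after the move gives \<open>D i + (int a - m) < int a\<close> on
        \<open>T\<close>; legality of the move gives the opposite bound off
        \<open>T\<close>.\<close>
      have low: "\<forall>i\<in>T. D i \<le> m"
        using k_stable_less[OF assms(1,2) T(4)] D' T(1) unfolding D'_def by fastforce
      have high: "\<forall>i\<in>{1..b} - T. m \<le> D i"
        using T(3) D' unfolding legal_backfire_def nonneg_config_def D'_def by fastforce
      obtain ys zs where yz: "wealths b D = ys @ zs" "length ys = t"
          "\<forall>y\<in>set ys. 0 \<le> y \<and> y \<le> m" "\<forall>z\<in>set zs. m \<le> z \<and> z \<le> int a"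
          "wealths b D' = map (\<lambda>z. z - m) zs @ map (\<lambda>y. y + (int a - m)) ys"
        using wealths_shift[OF T(1) _ assms(5) low high D'] D_less unfolding t_def by fastforce
      have sorted: "sorted ys" "sorted zs"
        using ws(1) yz(1) by (auto simp: sorted_append)
      have Q: "Q = upath m 0 ys @ upath (int a) m zs"
        unfolding Q_def yz(1) using yz sorted \<open>0 \<le> m\<close> \<open>m < int a\<close> by (intro upath_append) auto
      have "upath (int a) m zs @ upath m 0 ys = upath (int a) 0 (wealths b D')"
        unfolding yz(5) using yz sorted \<open>0 \<le> m\<close> \<open>m < int a\<close> by (intro upath_rotate) auto
      then have "cyclic_shift (length (upath m 0 ys)) Q = upath (int a) 0 (wealths b D')"
        by (simp add: cyclic_shift_def Q)
      moreover have "last_norths_nonneg a b k (upath (int a) 0 (wealths b D'))"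
        using T(3,4) assms k_stable_iff_path[of b k D' a "int a"]
        by (simp add: D'_def legal_backfire_def)
      moreover have "level a b (path_vertex Q (length (upath m 0 ys))) > 0"
        using final_upath[OF sorted(1) yz(3) \<open>0 \<le> m\<close>] m(1) yz(2)
        unfolding vertex_level by (simp add: Q)
      ultimately show ?R
        by (intro exI[of _ "length (upath m 0 ys)"]) (simp add: Q)
    next
      assume ?R
      then obtain n where "final_level a b (take n Q) > 0"
          "last_norths_nonneg a b k (drop n Q @ take n Q)"
        by (auto simp: vertex_level cyclic_shift_def)
      moreover have "final_level a b Q = 0"
        by (simp add: final_level_def endQ level_def)
      ultimately obtain P S where PS: "P @ S = Q" "0 < final_level a b P"
          "final_level a b P \<le> int b" "last_norths_nonneg a b k (S @ P)"
        using low_violation[of a b "take n Q" "drop n Q" k] by auto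
      obtain m ys zs where yz: "wealths b D = ys @ zs" "0 \<le> m" "m \<le> int a" "\<forall>y\<in>set ys. y \<le> m"
          "\<forall>y\<in>set zs. m \<le> y" "P = upath m 0 ys" "S = upath (int a) m zs"
        using upath_split[of "int a" 0 "wealths b D" P S] ws PS(1) by (auto simp: Q_def)
      define t where "t = length ys"
      \<comment> \<open>These are the vertices whose north steps precede the cut at
        \<open>(m, t)\<close>.\<close>
      define T where "T = set (take t (vertex_order b D))"
      define D' where "D' = cluster_backfire a b T D"
      have "t \<le> b"
        using length_wealths[of b D] unfolding yz(1) by (simp add: t_def)
      then have cardT: "card T = t"
        by (simp add: T_def distinct_card distinct_vertex_order)
      have T: "T \<subseteq> {1..b}"
        unfolding T_def using set_take_subset set_vertex_order by metis
      have "map D (take t (vertex_order b D)) = ys" "map D (drop t (vertex_order b D)) = zs"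
        using yz(1) by (simp_all add: wealths_def t_def take_map[symmetric] drop_map[symmetric])
      then have D_T: "D ` T = set ys" and D_T': "D ` set (drop t (vertex_order b D)) = set zs"
        unfolding T_def by (metis set_map)+
      have "{1..b} - T \<subseteq> set (drop t (vertex_order b D))"
        unfolding T_def set_vertex_order[of b D, symmetric]
        by (metis Diff_subset_conv append_take_drop_id order_refl set_append)
      then have high: "\<forall>i\<in>{1..b} - T. m \<le> D i"
        using D_T' yz(5) by blast
      have low: "\<forall>i\<in>T. D i \<le> m"
        using D_T yz(4) by blast
      have sorted: "sorted ys" "sorted zs"
        using ws(1) yz(1) by (auto simp: sorted_append)
      have m: "0 < int a * int t - int b * m" "int a * int t - int b * m \<le> int b"
        using PS(2,3) final_upath[OF sorted(1) _ yz(2)] ws(2) yz by (simp_all add: t_def)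
      \<comment> \<open>In row 0 the level is \<open>- int b * m\<close>, which is never
        positive.\<close>
      then have "T \<noteq> {}"
        using cardT yz(2) by (auto simp: mult_less_0_iff)
      have D': "\<forall>i\<in>{1..b}. D' i = (if i \<in> T then D i + (int a - m) else D i - m)"
        unfolding D'_def using m T \<open>T \<noteq> {}\<close> assms(3) cardT
        by (intro ballI cluster_backfire_eq) auto
      have legal: "nonneg_config b D'"
        using D' high yz(3) assms(5) by (auto simp: nonneg_config_def)
      obtain ys' zs' where yz': "wealths b D = ys' @ zs'" "length ys' = t"
          "wealths b D' = map (\<lambda>z. z - m) zs' @ map (\<lambda>y. y + (int a - m)) ys'"
        using wealths_shift[OF T _ assms(5) low high D'] D_less cardT by fastforce
      \<comment> \<open>Both pairs split the same list after \<open>t\<close> entries.\<close>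
      then have "ys' = ys" "zs' = zs"
        using yz(1) by (simp_all add: t_def)
      have "S @ P = upath (int a) 0 (wealths b D')"
        unfolding yz'(3) yz(6,7) \<open>ys' = ys\<close> \<open>zs' = zs\<close>
        using yz ws sorted by (intro upath_rotate) auto
      then have "k_stable a b k D'"
        using PS(4) k_stable_iff_path[of b k D' a "int a"] assms legal by simp
      then show ?L
        using T \<open>T \<noteq> {}\<close> legal unfolding legal_backfire_def D'_def by blast
    qed
    then show ?thesis
      using True endQ stable unfolding labeled k_skeletal_def k_skeletal_path_def by blast
  qed
qed

end
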